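(* There exists a measure preserving system $(X,\mathcal{X},\mu,T_1,T_2)$ such that $T_1$ and $T_2$ generate a 2-step nilpotent group $\langle T_1,T_2\rangle$ whose action is ergodic, and such that for every real number $\ell>0$ there exists a set $A\in\mathcal{X}$ such that $$\mu(A\cap T_1^{-n}A\cap T_2^{-n}A)<\mu(A)^{\ell}\quad\text{for every integer } n\neq 0.$$
   Context: A measure preserving system is a tuple $(X,\mathcal{X},\mu,T_1,\ldots,T_d)$, where $(X,\mathcal{X},\mu)$ is a probability space and $T_1,\ldots,T_d\colon X\to X$ are (invertible, bimeasurable) maps such that for all $A\in\mathcal{X}$ and $1\le i\le d$, $T_i^{-1}A\in\mathcal{X}$ and $\mu(T_i^{-1}A)=\mu(A)$. $\langle T_1,\ldots,T_d\rangle$ denotes the group generated by $T_1,\ldots,T_d$. The system is ergodic for $\langle T_1,\ldots,T_d\rangle$ if, whenever $A\in\mathcal{X}$ satisfies $T_i^{-1}A=A$ for all $1\le i\le d$, one has $\mu(A)=0$ or $1$. For a group $G$, set $[a,b]=aba^{-1}b^{-1}$, $G_1=G$, and $G_{j+1}=[G_j,G]$ (the subgroup generated by all commutators $[a,b]$ with $a\in G_j$, $b\in G$); $G$ is $d$-step nilpotent if $G_{d+1}=\{1\}$. The single system works for all $\ell$; the set $A$ may depend on $\ell$ but not on $n$. *)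

theory Defs
  imports "HOL-Probability.Probability_Measure" "HOL-Algebra.Bij" "HOL-Algebra.Elementary_Groups"
begin

text \<open>
  Self-maps of \<open>space M\<close> are elements of \<^const>\<open>Bij\<close>, i.e. bijections of \<open>space M\<close> that are
  \<^const>\<open>undefined\<close> outside of it, so that equality of maps (and hence the group they generate
  in \<^const>\<open>BijGroup\<close>) only depends on the values on \<open>space M\<close>.
\<close>

definition measure_preserving_system :: "'a measure \<Rightarrow> ('a \<Rightarrow> 'a) list \<Rightarrow> bool" where
  "measure_preserving_system M Ts \<longleftrightarrow>
     prob_space M \<and>
     (\<forall>T\<in>set Ts.
        T \<in> Bij (space M) \<and>
        T \<in> measurable M M \<and>
        inv_into (space M) T \<in> measurable M M \<and>
        (\<forall>A\<in>sets M. emeasure M (T -` A \<inter> space M) = emeasure M A))"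

definition transformation_group :: "'a measure \<Rightarrow> ('a \<Rightarrow> 'a) list \<Rightarrow> ('a \<Rightarrow> 'a) monoid" where
  "transformation_group M Ts = subgroup_generated (BijGroup (space M)) (set Ts)"

definition ergodic_system :: "'a measure \<Rightarrow> ('a \<Rightarrow> 'a) list \<Rightarrow> bool" where
  "ergodic_system M Ts \<longleftrightarrow>
     (\<forall>A\<in>sets M. (\<forall>T\<in>set Ts. T -` A \<inter> space M = A) \<longrightarrow> measure M A = 0 \<or> measure M A = 1)"

definition commutator_subgroup :: "('a, 'b) monoid_scheme \<Rightarrow> 'a set \<Rightarrow> 'a set \<Rightarrow> 'a set" where
  "commutator_subgroup G H K =
     generate G {a \<otimes>\<^bsub>G\<^esub> b \<otimes>\<^bsub>G\<^esub> inv\<^bsub>G\<^esub> a \<otimes>\<^bsub>G\<^esub> inv\<^bsub>G\<^esub> b | a b. a \<in> H \<and> b \<in> K}"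

text \<open>
  The customary indexing of the lower central series starts at \<open>1\<close>:
  \<open>lower_central_series G j\<close> is the term usually written \<open>G\<^sub>j\<^sub>+\<^sub>1\<close>.
\<close>

primrec lower_central_series :: "('a, 'b) monoid_scheme \<Rightarrow> nat \<Rightarrow> 'a set" where
  "lower_central_series G 0 = carrier G"
| "lower_central_series G (Suc j) = commutator_subgroup G (lower_central_series G j) (carrier G)"

text \<open>As usual, \<open>d\<close>-step nilpotent means of nilpotency class at most \<open>d\<close>.\<close>

definition step_nilpotent :: "nat \<Rightarrow> ('a, 'b) monoid_scheme \<Rightarrow> bool" where
  "step_nilpotent d G \<longleftrightarrow> group G \<and> lower_central_series G d = {\<one>\<^bsub>G\<^esub>}"

text \<open>
  The set \<open>T\<^sup>-\<^sup>n A\<close> for an integer \<open>n\<close>, as the preimage of \<open>A\<close> under the power \<open>T\<^sup>n\<close> taken in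
  the group of bijections of \<open>space M\<close>.
\<close>

definition power_preimage :: "'a measure \<Rightarrow> ('a \<Rightarrow> 'a) \<Rightarrow> int \<Rightarrow> 'a set \<Rightarrow> 'a set" where
  "power_preimage M T n A = (T [^]\<^bsub>BijGroup (space M)\<^esub> n) -` A \<inter> space M"

end

theory Submission
  imports Defs "HOL-Analysis.Kronecker_Approximation_Theorem"
begin

text \<open>
  The space is the two-dimensional torus and the transformations are
  \<open>T\<^sub>1 (x, y) = (x + \<alpha>, y + x)\<close> and \<open>T\<^sub>2 (x, y) = (x + \<alpha>, y + 2 x)\<close>
  with \<open>\<alpha>\<close> irrational. Both belong to the group of skew maps
  \<open>(x, y) \<mapsto> (x + a, y + k x + c)\<close>, which multiply like Heisenberg matrices: a commutator of two of
  them rotates the second coordinate only and commutes with every skew map (\<open>commutator_skew\<close>).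

  What makes the pair useful is that \<open>T\<^sub>1\<^sup>n\<close> and \<open>T\<^sub>2\<^sup>n\<close> move \<open>y\<close> by \<open>w\<close> and \<open>2 w\<close>
  for one and the same \<open>w = n x + \<alpha> n (n - 1) / 2\<close>. If \<open>A\<close> consists of all points whose second
  coordinate lies in a set \<open>B\<close>, then a point of \<open>A\<close> that returns to \<open>A\<close> under both powers gives a
  progression \<open>y, y + w, y + 2 w\<close> in \<open>B\<close>. For \<open>n \<noteq> 0\<close> the difference \<open>w\<close> is uniformly
  distributed on the circle as \<open>x\<close> varies (\<open>distr_circle_affine\<close>), so it is enough to find \<open>B\<close> all
  of whose progressions have their difference in a set much smaller than any prescribed power of the
  measure of \<open>B\<close>. Thickening a Behrend set, that is a large set of integers without three-term
  progressions, gives such a \<open>B\<close> (\<open>exists_sparse_progression_set\<close>).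

  The commutator of \<open>T\<^sub>2\<close> and \<open>T\<^sub>1\<close> is the rotation of the second coordinate by \<open>\<alpha>\<close>. Hence every
  vertical fibre of an invariant set is invariant under an irrational rotation and has measure 0 or 1;
  the first coordinates of the full fibres again form a set invariant under rotation by \<open>\<alpha>\<close>.
  Ergodicity of the action thereby reduces to ergodicity of an irrational rotation of the circle
  (\<open>irrational_rotation_ergodic\<close>).
\<close>

section \<open>Rotations and the circle\<close>

text \<open>
  The group \<open>\<real> / \<int>\<close> with its Haar measure, represented on \<open>[0, 1)\<close>; the projection from
  \<open>\<real>\<close> is \<^const>\<open>frac\<close>.
\<close>

definition circle :: "real measure" where
  "circle = restrict_space lborel {0..<1}"

lemma space_circle [simp]: "space circle = {0..<1}"
  by (simp add: circle_def space_restrict_space)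

lemma sets_circle: "sets circle = sets (restrict_space borel {0..<1})"
  unfolding circle_def by (rule sets_restrict_space_cong) simp

lemma sets_circle_iff: "B \<in> sets circle \<longleftrightarrow> B \<in> sets borel \<and> B \<subseteq> {0..<1}"
  by (subst sets_circle, subst sets_restrict_space_iff) auto

lemma emeasure_circle: "B \<subseteq> {0..<1} \<Longrightarrow> emeasure circle B = emeasure lborel B"
  unfolding circle_def by (subst emeasure_restrict_space) auto

lemma prob_space_circle: "prob_space circle"
  by (rule prob_spaceI) (simp add: emeasure_circle)

interpretation circle: prob_space circle
  by (rule prob_space_circle)

lemma measurable_circle_borel [measurable_dest]:
  "B \<in> sets circle \<Longrightarrow> B \<in> sets borel"
  by (simp add: sets_circle_iff)

lemma measurable_frac [measurable]: "frac \<in> borel \<rightarrow>\<^sub>M circle"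
proof -
  have "(frac :: real \<Rightarrow> real) \<in> borel \<rightarrow>\<^sub>M borel"
    unfolding frac_def by measurable
  moreover have "(frac :: real \<Rightarrow> real) \<in> space borel \<rightarrow> {0..<1}"
    by (auto simp: frac_lt_1)
  ultimately show ?thesis
    unfolding measurable_cong_sets[OF refl sets_circle] by (intro measurable_restrict_space2) auto
qed

lemma measurable_id_circle_borel [measurable]: "(\<lambda>x. x) \<in> circle \<rightarrow>\<^sub>M borel"
  unfolding measurable_cong_sets[OF sets_circle refl] by (intro measurable_restrict_space1) simp

lemma emeasure_lborel_translate:
  fixes B :: "real set"
  assumes [measurable]: "B \<in> sets borel"
  shows "emeasure lborel {x. x + t \<in> B} = emeasure lborel B"
proof -
  have "emeasure lborel B = emeasure (distr lborel borel ((+) t)) B"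
    by (simp add: lborel_distr_plus)
  also have "\<dots> = emeasure lborel {x. x + t \<in> B}"
    by (subst emeasure_distr) (auto simp: vimage_def add.commute)
  finally show ?thesis by simp
qed

text \<open>
  Rotation by \<open>t\<close> cuts the interval at \<open>1 - frac t\<close> and translates the two pieces so that they change
  places.
\<close>

lemma emeasure_circle_rotation:
  assumes "B \<in> sets circle"
  shows "emeasure circle {x \<in> {0..<1}. frac (x + t) \<in> B} = emeasure circle B"
proof -
  define s where "s = frac t"
  have s: "0 \<le> s" "s < 1" by (auto simp: s_def frac_lt_1)
  have [measurable]: "B \<in> sets borel" and B: "B \<subseteq> {0..<1}"
    using assms by (auto simp: sets_circle_iff)
  have fr: "frac (x + t) = (if x + s < 1 then x + s else x + (s - 1))" if "x \<in> {0..<1}" for x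
    using that unfolding s_def by (simp add: frac_add frac_eq_id)
  have split: "{x \<in> {0..<1}. frac (x + t) \<in> B} =
      {x. x + s \<in> B \<inter> {s..<1}} \<union> {x. x + (s - 1) \<in> B \<inter> {0..<s}}"
    using s B by (auto simp: fr split: if_splits)
  have "emeasure circle {x \<in> {0..<1}. frac (x + t) \<in> B} = emeasure lborel {x \<in> {0..<1}. frac (x + t) \<in> B}"
    by (rule emeasure_circle) blast
  also have "\<dots> = emeasure lborel {x. x + s \<in> B \<inter> {s..<1}}
      + emeasure lborel {x. x + (s - 1) \<in> B \<inter> {0..<s}}"
    unfolding split
  proof (rule plus_emeasure[symmetric])
    show "{x. x + s \<in> B \<inter> {s..<1}} \<in> sets lborel" "{x. x + (s - 1) \<in> B \<inter> {0..<s}} \<in> sets lborel"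
      by measurable
  qed (use s in auto)
  also have "\<dots> = emeasure lborel (B \<inter> {s..<1}) + emeasure lborel (B \<inter> {0..<s})"
    by (subst (1 2) emeasure_lborel_translate) simp_all
  also have "\<dots> = emeasure lborel (B \<inter> {s..<1} \<union> B \<inter> {0..<s})"
    by (rule plus_emeasure) auto
  also have "B \<inter> {s..<1} \<union> B \<inter> {0..<s} = B"
    using B s by auto
  finally show ?thesis by (simp add: emeasure_circle B)
qed

lemma measurable_rotation: "(\<lambda>x. frac (x + t)) \<in> circle \<rightarrow>\<^sub>M circle"
  by measurable

lemma distr_circle_rotation: "distr circle circle (\<lambda>x. frac (x + t)) = circle"
proof (rule measure_eqI)
  fix B assume "B \<in> sets (distr circle circle (\<lambda>x. frac (x + t)))"
  then have B: "B \<in> sets circle" by simp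
  have "(\<lambda>x. frac (x + t)) -` B \<inter> space circle = {x \<in> {0..<1}. frac (x + t) \<in> B}" by auto
  then show "emeasure (distr circle circle (\<lambda>x. frac (x + t))) B = emeasure circle B"
    using B by (simp only: emeasure_distr measurable_rotation emeasure_circle_rotation)
qed simp

text \<open>
  Uniqueness of Haar measure. The measure of \<open>{(x, t). x + t \<in> B}\<close> under the product of \<open>N\<close> and
  the circle measure can be computed in both orders: integrating over \<open>x\<close> first gives \<open>N B\<close>, by
  the invariance of \<open>N\<close>, and integrating over \<open>t\<close> first gives the circle measure of \<open>B\<close>.
\<close>

lemma rotation_invariant_imp_circle:
  assumes "prob_space N" and sets: "sets N = sets circle"
    and inv: "\<And>t B. B \<in> sets circle \<Longrightarrow> emeasure N {x \<in> {0..<1}. frac (x + t) \<in> B} = emeasure N B"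
  shows "N = circle"
proof (rule measure_eqI)
  interpret N: prob_space N by fact
  interpret pair_sigma_finite N circle ..
  note [measurable_cong] = sets
  have sp: "space N = {0..<1}" using sets_eq_imp_space_eq[OF sets] by simp
  have idN [measurable]: "(\<lambda>x. x) \<in> N \<rightarrow>\<^sub>M borel"
    using measurable_id_circle_borel by (simp add: measurable_cong_sets[OF sets refl])
  fix B assume "B \<in> sets N"
  then have [measurable]: "B \<in> sets circle" by (simp add: sets)
  let ?Q = "{p \<in> space (N \<Otimes>\<^sub>M circle). frac (fst p + snd p) \<in> B}"
  have [measurable]: "fst \<in> N \<Otimes>\<^sub>M circle \<rightarrow>\<^sub>M borel" "snd \<in> N \<Otimes>\<^sub>M circle \<rightarrow>\<^sub>M borel"
    using measurable_compose[OF measurable_fst idN] measurable_compose[OF measurable_snd measurable_id_circle_borel]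
    by (auto simp: eta_contract_eq)
  have Q: "?Q \<in> sets (N \<Otimes>\<^sub>M circle)" by measurable
  have "emeasure N B = (\<integral>\<^sup>+t. emeasure N B \<partial>circle)"
    by (simp add: circle.emeasure_space_1[simplified])
  also have "\<dots> = (\<integral>\<^sup>+t. emeasure N ((\<lambda>x. (x, t)) -` ?Q) \<partial>circle)"
  proof (rule nn_integral_cong)
    fix t assume "t \<in> space circle"
    then have "(\<lambda>x. (x, t)) -` ?Q = {x \<in> {0..<1}. frac (x + t) \<in> B}"
      by (auto simp: space_pair_measure sp)
    then show "emeasure N B = emeasure N ((\<lambda>x. (x, t)) -` ?Q)" by (simp only: inv \<open>B \<in> sets circle\<close>)
  qed
  also have "\<dots> = emeasure (N \<Otimes>\<^sub>M circle) ?Q"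
    by (rule emeasure_pair_measure_alt2[symmetric, OF Q])
  also have "\<dots> = (\<integral>\<^sup>+x. emeasure circle (Pair x -` ?Q) \<partial>N)"
    by (rule circle.emeasure_pair_measure_alt[OF Q])
  also have "\<dots> = (\<integral>\<^sup>+x. emeasure circle B \<partial>N)"
  proof (rule nn_integral_cong)
    fix x assume "x \<in> space N"
    then have "Pair x -` ?Q = {t \<in> {0..<1}. frac (t + x) \<in> B}"
      by (auto simp: space_pair_measure sp add.commute)
    then show "emeasure circle (Pair x -` ?Q) = emeasure circle B"
      by (simp only: emeasure_circle_rotation \<open>B \<in> sets circle\<close>)
  qed
  also have "\<dots> = emeasure circle B" by (simp add: N.emeasure_space_1)
  finally show "emeasure N B = emeasure circle B" .
qed (rule sets)

text \<open>
  Rotating the image point by \<open>t\<close> amounts to rotating \<open>x\<close> by \<open>t / n\<close>, so the image measure is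
  rotation invariant.
\<close>

lemma distr_circle_affine:
  fixes n :: int
  assumes "n \<noteq> 0"
  shows "distr circle circle (\<lambda>x. frac (real_of_int n * x + c)) = circle"
proof (rule rotation_invariant_imp_circle)
  show "prob_space (distr circle circle (\<lambda>x. frac (real_of_int n * x + c)))"
    by (rule circle.prob_space_distr) measurable
next
  fix t B assume [measurable]: "B \<in> sets circle"
  let ?f = "\<lambda>x. frac (real_of_int n * x + c)"
  have eq: "?f (frac (x + t / n)) = frac (n * x + c + t)" for x :: real
  proof -
    have "?f (frac (x + t / n)) = frac (n * x + t + c + of_int (- n * \<lfloor>x + t / n\<rfloor>))"
      using assms by (simp add: frac_def algebra_simps)
    also have "\<dots> = frac (n * x + t + c)" by (rule frac_add_of_int_right)
    finally show ?thesis by (simp add: add_ac)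
  qed
  have "emeasure (distr circle circle ?f) {x \<in> {0..<1}. frac (x + t) \<in> B} =
      emeasure circle {x \<in> {0..<1}. frac (?f x + t) \<in> B}"
  proof (subst emeasure_distr)
    have "{x \<in> space circle. frac (x + t) \<in> B} \<in> sets circle" by measurable
    then show "{x \<in> {0..<1}. frac (x + t) \<in> B} \<in> sets circle" by simp
    show "emeasure circle (?f -` {x \<in> {0..<1}. frac (x + t) \<in> B} \<inter> space circle) =
      emeasure circle {x \<in> {0..<1}. frac (?f x + t) \<in> B}"
      by (rule arg_cong[of _ _ "emeasure circle"]) (auto simp: frac_lt_1)
  qed measurable
  also have "\<dots> = emeasure circle {x \<in> {0..<1}. frac (x + t / n) \<in> ?f -` B \<inter> space circle}"
    by (rule arg_cong[of _ _ "emeasure circle"]) (auto simp: eq frac_lt_1)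
  also have "\<dots> = emeasure circle (?f -` B \<inter> space circle)"
    by (rule emeasure_circle_rotation) measurable
  also have "\<dots> = emeasure (distr circle circle ?f) B"
    by (simp add: emeasure_distr)
  finally show "emeasure (distr circle circle ?f) {x \<in> {0..<1}. frac (x + t) \<in> B} =
    emeasure (distr circle circle ?f) B" .
qed simp

text \<open>
  Let \<open>A'\<close> be the periodic subset of the line that lies over \<open>A\<close>. It is invariant under the dense
  group \<open>\<int> + \<alpha> \<int>\<close>, and the measure of \<open>A' \<inter> (a + t, b + t)\<close> is Lipschitz in \<open>t\<close>; hence
  this measure does not depend on \<open>t\<close>. Averaging it over \<open>t \<in> [0, 1)\<close> shows that \<open>A'\<close> takes up
  the fraction \<open>\<mu>(A)\<close> of every interval. If \<open>\<mu>(A) > 0\<close>, then Lebesgue measure restricted to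
  \<open>A'\<close> and divided by \<open>\<mu>(A)\<close> agrees with Lebesgue measure on intervals, so on all Borel sets, and
  the complement of \<open>A\<close> is null.
\<close>

lemma irrational_rotation_ergodic:
  assumes "\<alpha> \<notin> \<rat>" and A: "A \<in> sets circle"
    and inv: "\<And>x. x \<in> {0..<1} \<Longrightarrow> frac (x + \<alpha>) \<in> A \<longleftrightarrow> x \<in> A"
  shows "emeasure circle A = 0 \<or> emeasure circle A = 1"
proof -
  have [measurable]: "A \<in> sets circle" by fact
  define A' where "A' = {x. frac x \<in> A}"
  have [measurable]: "A' \<in> sets borel" 
  proof -
    have "A' = frac -` A \<inter> space borel" by (auto simp: A'_def)
    also have "\<dots> \<in> sets borel" by measurable
    finally show ?thesis .
  qed
  have shift1: "x + \<alpha> \<in> A' \<longleftrightarrow> x \<in> A'" for x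
    using inv[of "frac x"] by (simp add: A'_def frac_lt_1)
  have shiftn: "x + of_nat m * \<alpha> \<in> A' \<longleftrightarrow> x \<in> A'" for x m
  proof (induction m)
    case (Suc m)
    then show ?case using shift1[of "x + of_nat m * \<alpha>"] by (simp add: algebra_simps)
  qed simp
  have shift: "x + (of_int k * \<alpha> - of_int h) \<in> A' \<longleftrightarrow> x \<in> A'" for x k h
  proof -
    have *: "x + of_int k * \<alpha> \<in> A' \<longleftrightarrow> x \<in> A'"
    proof (cases "k \<ge> 0")
      case True then show ?thesis using shiftn[of x "nat k"] by simp
    next
      case False then show ?thesis using shiftn[of "x + of_int k * \<alpha>" "nat (- k)"] by simp
    qed
    have "frac (x + (of_int k * \<alpha> - of_int h)) = frac (x + of_int k * \<alpha> + of_int (- h))"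
      by (simp add: algebra_simps)
    also have "\<dots> = frac (x + of_int k * \<alpha>)" by (rule frac_add_of_int_right)
    finally show ?thesis using * by (simp add: A'_def)
  qed
  define \<phi> where "\<phi> a b t = emeasure lborel (A' \<inter> {a + t<..<b + t})" for a b t
  \<comment> \<open>Moving an interval by \<open>\<bar>t - s\<bar>\<close> adds at most a piece of that length at either end.\<close>
  have lip: "\<phi> a b t \<le> \<phi> a b s + ennreal (2 * \<bar>t - s\<bar>)" for a b t s
  proof -
    let ?e = "\<bar>t - s\<bar>"
    have "\<phi> a b t \<le> emeasure lborel ((A' \<inter> {a + s<..<b + s}) \<union> ({a + s - ?e..a + s} \<union> {b + s..b + s + ?e}))"
      unfolding \<phi>_def by (rule emeasure_mono) auto
    also have "\<dots> \<le> \<phi> a b s + emeasure lborel ({a + s - ?e..a + s} \<union> {b + s..b + s + ?e})"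
      unfolding \<phi>_def by (rule emeasure_subadditive) auto
    also have "emeasure lborel ({a + s - ?e..a + s} \<union> {b + s..b + s + ?e}) \<le>
        emeasure lborel {a + s - ?e..a + s} + emeasure lborel {b + s..b + s + ?e}"
      by (rule emeasure_subadditive) auto
    also have "\<dots> = ennreal (2 * ?e)" by (simp flip: ennreal_plus)
    finally show ?thesis by (simp add: add_left_mono)
  qed
  have per: "\<phi> a b (of_int k * \<alpha> - of_int h) = \<phi> a b 0" for a b k h
  proof -
    have "\<phi> a b 0 = emeasure lborel {x. x + - (of_int k * \<alpha> - of_int h) \<in> A' \<inter> {a<..<b}}"
      unfolding \<phi>_def by (subst emeasure_lborel_translate) auto
    also have "{x. x + - (of_int k * \<alpha> - of_int h) \<in> A' \<inter> {a<..<b}} =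
       A' \<inter> {a + (of_int k * \<alpha> - of_int h)<..<b + (of_int k * \<alpha> - of_int h)}"
      using shift[of _ "- k" "- h"] by (auto simp: algebra_simps)
    finally show ?thesis by (simp add: \<phi>_def)
  qed
  have const: "\<phi> a b t = \<phi> a b 0" for a b t
  proof -
    have close: "\<phi> a b t \<le> \<phi> a b 0 + ennreal e \<and> \<phi> a b 0 \<le> \<phi> a b t + ennreal e" if "e > 0" for e
    proof -
      have "e / 2 > 0" using \<open>e > 0\<close> by simp
      then obtain h k where hk: "\<bar>of_int k * \<alpha> - of_int h - t\<bar> < e / 2"
        using sequence_of_fractional_parts_is_dense[OF \<open>\<alpha> \<notin> \<rat>\<close>, where \<alpha> = t] by blast
      define r where "r = of_int k * \<alpha> - of_int h"
      have r: "\<phi> a b r = \<phi> a b 0" by (simp add: r_def per)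
      have "ennreal (2 * \<bar>t - r\<bar>) \<le> ennreal e" "ennreal (2 * \<bar>r - t\<bar>) \<le> ennreal e"
        using hk unfolding r_def by (intro ennreal_leI; argo)+
      then show ?thesis
        using lip[of a b t r] lip[of a b r t] unfolding r
        by (meson add_left_mono order_trans)
    qed
    show ?thesis
    proof (rule antisym)
      show "\<phi> a b t \<le> \<phi> a b 0" by (rule ennreal_le_epsilon) (use close in auto)
      show "\<phi> a b 0 \<le> \<phi> a b t" by (rule ennreal_le_epsilon) (use close in auto)
    qed
  qed
  have avg: "emeasure lborel (A' \<inter> {a<..<b}) = ennreal (b - a) * emeasure circle A" if "a \<le> b" for a b
  proof -
    interpret pair_sigma_finite lborel circle ..
    \<comment> \<open>After substituting \<open>x + t\<close> for \<open>x\<close>, the average over \<open>t\<close> is the measure of \<open>?Q\<close>; its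
      sections at fixed \<open>x\<close> are rotations of \<open>A\<close>.\<close>
    let ?Q = "{p \<in> space (lborel \<Otimes>\<^sub>M circle). fst p \<in> {a<..<b} \<and> frac (fst p + snd p) \<in> A}"
    have [measurable]: "snd \<in> lborel \<Otimes>\<^sub>M circle \<rightarrow>\<^sub>M borel"
      using measurable_compose[OF measurable_snd measurable_id_circle_borel]
      by (auto simp: eta_contract_eq)
    have Q: "?Q \<in> sets (lborel \<Otimes>\<^sub>M circle)" by measurable
    have "emeasure lborel (A' \<inter> {a<..<b}) = (\<integral>\<^sup>+t. \<phi> a b 0 \<partial>circle)"
      by (simp add: \<phi>_def circle.emeasure_space_1[simplified])
    also have "\<dots> = (\<integral>\<^sup>+t. emeasure lborel ((\<lambda>x. (x, t)) -` ?Q) \<partial>circle)"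
    proof (rule nn_integral_cong)
      fix t assume t: "t \<in> space circle"
      have "\<phi> a b 0 = \<phi> a b t" by (rule const[symmetric])
      also have "\<dots> = emeasure lborel {x. x + t \<in> A' \<inter> {a + t<..<b + t}}"
        unfolding \<phi>_def by (rule emeasure_lborel_translate[symmetric]) measurable
      also have "{x. x + t \<in> A' \<inter> {a + t<..<b + t}} = (\<lambda>x. (x, t)) -` ?Q"
        using t by (auto simp: space_pair_measure A'_def)
      finally show "\<phi> a b 0 = emeasure lborel ((\<lambda>x. (x, t)) -` ?Q)" .
    qed
    also have "\<dots> = emeasure (lborel \<Otimes>\<^sub>M circle) ?Q"
      by (rule emeasure_pair_measure_alt2[symmetric, OF Q])
    also have "\<dots> = (\<integral>\<^sup>+x. emeasure circle (Pair x -` ?Q) \<partial>lborel)"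
      by (rule circle.emeasure_pair_measure_alt[OF Q])
    also have "\<dots> = (\<integral>\<^sup>+x. emeasure circle A * indicator {a<..<b} x \<partial>lborel)"
    proof (rule nn_integral_cong)
      fix x :: real
      have "Pair x -` ?Q = (if x \<in> {a<..<b} then {t \<in> {0..<1}. frac (t + x) \<in> A} else {})"
        by (auto simp: space_pair_measure add.commute)
      then show "emeasure circle (Pair x -` ?Q) = emeasure circle A * indicator {a<..<b} x"
        using emeasure_circle_rotation[OF A, of x] by simp
    qed
    also have "\<dots> = emeasure circle A * ennreal (b - a)"
      using that by (subst nn_integral_cmult_indicator) auto
    finally show ?thesis by (simp add: mult.commute)
  qed
  show ?thesis
  proof (rule ccontr)
    assume neg: "\<not> ?thesis"
    then have "emeasure circle A \<noteq> 0" by simp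
    define p where "p = measure circle A"
    have p: "emeasure circle A = ennreal p" by (simp add: p_def circle.emeasure_eq_measure)
    have "p \<noteq> 0" using \<open>emeasure circle A \<noteq> 0\<close> by (auto simp: p)
    then have "p > 0" using measure_nonneg[of circle A] by (simp add: p_def less_le)
    let ?N = "density lborel (\<lambda>x. ennreal (1 / p) * indicator A' x)"
    have N: "emeasure ?N B = ennreal (1 / p) * emeasure lborel (A' \<inter> B)" if [measurable]: "B \<in> sets borel" for B
    proof -
      have "emeasure ?N B = (\<integral>\<^sup>+x. ennreal (1 / p) * indicator (A' \<inter> B) x \<partial>lborel)"
        by (subst emeasure_density) (auto simp: indicator_inter_arith mult.assoc)
      also have "\<dots> = ennreal (1 / p) * emeasure lborel (A' \<inter> B)"
        by (rule nn_integral_cmult_indicator) simp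
      finally show ?thesis .
    qed
    have "lborel = ?N"
    proof (rule lborel_eqI)
      fix l u :: real assume "\<And>b. b \<in> Basis \<Longrightarrow> l \<bullet> b \<le> u \<bullet> b"
      then have "l \<le> u" by simp
      then show "emeasure ?N (box l u) = ennreal (\<Prod>b\<in>Basis. (u - l) \<bullet> b)"
        using \<open>p > 0\<close> by (simp add: N box_real avg p flip: ennreal_mult)
    qed simp
    then have "emeasure lborel ({0..<1} - A) = emeasure ?N ({0..<1} - A)" by simp
    also have "\<dots> = 0"
    proof -
      have "A' \<inter> ({0..<1} - A) = {}" by (auto simp: A'_def frac_eq_id)
      then show ?thesis by (simp add: N)
    qed
    finally have "emeasure circle (space circle - A) = 0" by (simp add: emeasure_circle)
    then have "emeasure circle A = 1"
      using circle.prob_compl[OF A] by (simp add: circle.emeasure_eq_measure)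
    then show False using neg by simp
  qed
qed

section \<open>Sets with few three-term progressions\<close>

fun from_digits :: "nat \<Rightarrow> nat list \<Rightarrow> nat" where
  "from_digits b [] = 0"
| "from_digits b (x # xs) = x + b * from_digits b xs"

definition sum_squares :: "nat list \<Rightarrow> nat" where
  "sum_squares xs = (\<Sum>x\<leftarrow>xs. x\<^sup>2)"

lemma from_digits_less:
  assumes "set xs \<subseteq> {..<b}"
  shows "from_digits b xs < b ^ length xs"
  using assms
proof (induction xs)
  case (Cons x xs)
  then have "x < b" and "from_digits b xs + 1 \<le> b ^ length xs" by auto
  then have "b * (from_digits b xs + 1) \<le> b * b ^ length xs" by (intro mult_left_mono) auto
  then show ?case using \<open>x < b\<close> by simp
qed simp

text \<open>
  Strict convexity of the square: if \<open>x \<le> z\<close>, then writing \<open>y = x + e\<close> and \<open>z = x + 2 e\<close>, the defect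
  \<open>x\<^sup>2 + z\<^sup>2 - 2 y\<^sup>2\<close> equals \<open>2 e\<^sup>2\<close>; the case \<open>z \<le> x\<close> is symmetric.
\<close>

lemma midpoint_squares:
  fixes x y z :: nat
  assumes "x + z = 2 * y"
  shows "2 * y\<^sup>2 \<le> x\<^sup>2 + z\<^sup>2" and "2 * y\<^sup>2 = x\<^sup>2 + z\<^sup>2 \<Longrightarrow> x = y \<and> z = y"
proof -
  have *: "a\<^sup>2 + (a + 2 * e)\<^sup>2 = 2 * (a + e)\<^sup>2 + 2 * e\<^sup>2" for a e :: nat
    by (simp add: power2_eq_square algebra_simps)
  consider e where "y = x + e" "z = x + 2 * e" | e where "y = z + e" "x = z + 2 * e"
  proof (cases "x \<le> z")
    case True then show ?thesis using that(1)[of "y - x"] assms by simp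
  next
    case False then show ?thesis using that(2)[of "y - z"] assms by simp
  qed
  then have "2 * y\<^sup>2 \<le> x\<^sup>2 + z\<^sup>2 \<and> (2 * y\<^sup>2 = x\<^sup>2 + z\<^sup>2 \<longrightarrow> x = y \<and> z = y)"
  proof cases
    case 1 then show ?thesis using *[of x e] by simp
  next
    case 2 then show ?thesis using *[of z e] by (simp add: add.commute)
  qed
  then show "2 * y\<^sup>2 \<le> x\<^sup>2 + z\<^sup>2" and "2 * y\<^sup>2 = x\<^sup>2 + z\<^sup>2 \<Longrightarrow> x = y \<and> z = y" by auto
qed

text \<open>
  Digits below \<open>d\<close> in base \<open>2 d\<close> can be added without carry, so a midpoint relation between numbers
  is a midpoint relation in each digit, and convexity can be applied digit by digit. In particular
  three digit strings on one sphere around 0 are never in progression unless they coincide.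
\<close>

lemma digits_midpoint:
  assumes "length xs = length ys" "length ys = length zs"
    and "set xs \<subseteq> {..<d}" "set ys \<subseteq> {..<d}" "set zs \<subseteq> {..<d}"
    and "from_digits (2 * d) xs + from_digits (2 * d) zs = 2 * from_digits (2 * d) ys"
  shows "2 * sum_squares ys \<le> sum_squares xs + sum_squares zs \<and>
    (2 * sum_squares ys = sum_squares xs + sum_squares zs \<longrightarrow> xs = ys \<and> zs = ys)"
  using assms
proof (induction xs ys zs rule: list_induct3)
  case (Cons x xs y ys z zs)
  let ?v = "from_digits (2 * d)"
  have lt: "x + z < 2 * d" "2 * y < 2 * d" using Cons.prems by auto
  have eq: "(x + z) + 2 * d * (?v xs + ?v zs) = 2 * y + 2 * d * (2 * ?v ys)"
    using Cons.prems by (simp add: algebra_simps)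
  have "x + z = ((x + z) + 2 * d * (?v xs + ?v zs)) mod (2 * d)"
    using lt by simp
  also have "\<dots> = 2 * y mod (2 * d)" unfolding eq by (rule mod_mult_self2)
  also have "\<dots> = 2 * y" using lt by simp
  finally have head: "x + z = 2 * y" .
  with eq lt have tail: "?v xs + ?v zs = 2 * ?v ys" by simp
  have "2 * sum_squares ys \<le> sum_squares xs + sum_squares zs \<and>
    (2 * sum_squares ys = sum_squares xs + sum_squares zs \<longrightarrow> xs = ys \<and> zs = ys)"
    using Cons.prems tail by (intro Cons.IH) auto
  with midpoint_squares[OF head] show ?case
    by (auto simp: sum_squares_def)
qed (simp add: sum_squares_def)

lemma sum_squares_less:
  assumes "set xs \<subseteq> {..<d}" "xs \<noteq> []"
  shows "sum_squares xs < length xs * d\<^sup>2"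
proof -
  have "(\<Sum>x\<leftarrow>xs. x\<^sup>2) < (\<Sum>x\<leftarrow>xs. d\<^sup>2)"
    using assms by (intro sum_list_strict_mono power_strict_mono) auto
  then show ?thesis by (simp add: sum_squares_def sum_list_triv)
qed

text \<open>
  Behrend's construction: the \<open>d\<^sup>k\<close> digit strings of length \<open>k\<close> lie on at most \<open>k d\<^sup>2\<close>
  spheres, and the numbers with digits on a most popular sphere form \<open>S\<close>.
\<close>

lemma exists_large_progression_free_set:
  assumes "k > 0" "d > 0"
  obtains S where "S \<subseteq> {..<(2 * d) ^ k}" "d ^ k \<le> card S * (k * d\<^sup>2)"
    "\<And>x y z. \<lbrakk>x \<in> S; y \<in> S; z \<in> S; x + z = 2 * y\<rbrakk> \<Longrightarrow> x = y"
proof -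
  define L where "L = {xs. set xs \<subseteq> {..<d} \<and> length xs = k}"
  define F where "F r = {xs \<in> L. sum_squares xs = r}" for r
  have card_L: "card L = d ^ k"
    unfolding L_def by (simp add: card_lists_length_eq)
  have bound: "sum_squares xs < k * d\<^sup>2" if "xs \<in> L" for xs
    using sum_squares_less[of xs d] that \<open>k > 0\<close> by (auto simp: L_def)
  have "\<exists>r. d ^ k \<le> card (F r) * (k * d\<^sup>2)"
  proof (rule ccontr)
    assume *: "\<not> ?thesis"
    \<comment> \<open>Otherwise the fibres of the sum of squares would be too small to cover \<open>L\<close>.\<close>
    have "L = (\<Union>r<k * d\<^sup>2. F r)" using bound by (auto simp: F_def)
    then have "card L \<le> (\<Sum>r<k * d\<^sup>2. card (F r))" by (simp add: card_UN_le)
    then have "d ^ k * (k * d\<^sup>2) \<le> (\<Sum>r<k * d\<^sup>2. card (F r)) * (k * d\<^sup>2)"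
      unfolding card_L by (rule mult_right_mono) simp
    also have "\<dots> = (\<Sum>r<k * d\<^sup>2. card (F r) * (k * d\<^sup>2))" by (rule sum_distrib_right)
    also have "\<dots> < (\<Sum>r<k * d\<^sup>2. d ^ k)"
      using * assms by (intro sum_strict_mono) (auto simp: not_le lessThan_empty_iff)
    finally show False by simp
  qed
  then obtain r where r: "d ^ k \<le> card (F r) * (k * d\<^sup>2)" by blast
  let ?v = "from_digits (2 * d)"
  have mid: "xs = ys" if "xs \<in> F r" "ys \<in> F r" "zs \<in> F r" "?v xs + ?v zs = 2 * ?v ys" for xs ys zs
    using digits_midpoint[of xs ys zs d] that by (auto simp: F_def L_def)
  have "inj_on ?v (F r)"
    by (rule inj_onI) (use mid in auto)
  then have card: "card (?v ` F r) = card (F r)" by (rule card_image)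
  show ?thesis
  proof (rule that[of "?v ` F r"])
    show "?v ` F r \<subseteq> {..<(2 * d) ^ k}"
      using from_digits_less[of _ "2 * d"] by (fastforce simp: F_def L_def)
    show "d ^ k \<le> card (?v ` F r) * (k * d\<^sup>2)" using r by (simp add: card)
    show "x = y" if "x \<in> ?v ` F r" "y \<in> ?v ` F r" "z \<in> ?v ` F r" "x + z = 2 * y" for x y z
      using mid that by blast
  qed
qed

text \<open>
  A progression-free set \<open>S\<close> of integers below \<open>N\<close> is turned into the union \<open>B\<close> of the intervals
  \<open>[2 h s, 2 h s + h)\<close> with \<open>s \<in> S\<close> and \<open>h = 1 / (4 N)\<close>. As \<open>B\<close> lies in the first half of the
  circle, progressions modulo 1 in \<open>B\<close> are progressions of reals; as the intervals fill only half
  of each step \<open>2 h\<close>, the indices of the intervals visited are in progression too, hence equal. So the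
  difference of a progression in \<open>B\<close> is within \<open>h\<close> of 0 modulo 1.

  The measure of \<open>B\<close> is at least of order \<open>1 / d\<^sup>2\<close> for fixed \<open>k\<close>, whereas \<open>h\<close> is of order
  \<open>1 / d\<^sup>k\<close>. Taking \<open>k > 2 L\<close> and then \<open>d\<close> large makes \<open>2 h\<close> smaller than the \<open>L\<close>-th
  power of the measure.
\<close>

lemma exists_sparse_progression_set:
  fixes L :: nat
  obtains B :: "real set" and h :: real where "B \<in> sets borel" "B \<subseteq> {0..<1}" "0 < h" "h \<le> 1/2"
    "2 * h < measure lborel B ^ L"
    "\<And>y w. \<lbrakk>y \<in> B; frac (y + w) \<in> B; frac (y + 2 * w) \<in> B\<rbrakk> \<Longrightarrow> frac w \<in> {0..<h} \<union> {1 - h<..<1}"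
proof -
  define k where "k = 2 * L + 1"
  \<comment> \<open>\<open>B\<close> will have measure at least \<open>1 / (k 2\<^bsup>k+2\<^esup> d\<^sup>2)\<close>. The \<open>L\<close>-th power of
    \<open>k 2\<^bsup>k+2\<^esup> d\<^sup>2\<close> should be \<open>d\<^sup>k\<close>; with \<open>k = 2 L + 1\<close> this is the choice of \<open>d\<close>.\<close>
  define d where "d = (k * 2 ^ (k + 2)) ^ L"
  define N where "N = (2 * d) ^ k"
  have "k > 0" "d > 0" "N > 0" by (auto simp: k_def d_def N_def)
  obtain S where S: "S \<subseteq> {..<N}" "d ^ k \<le> card S * (k * d\<^sup>2)"
      and free: "\<And>x y z. \<lbrakk>x \<in> S; y \<in> S; z \<in> S; x + z = 2 * y\<rbrakk> \<Longrightarrow> x = y"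
    using exists_large_progression_free_set[OF \<open>k > 0\<close> \<open>d > 0\<close>] unfolding N_def by metis
  have finS: "finite S" using S(1) finite_subset by blast
  define h where "h = 1 / (4 * real N)"
  have "h > 0" using \<open>N > 0\<close> by (simp add: h_def)
  have h_eq: "2 * real N * h = 1 / 2" using \<open>N > 0\<close> by (simp add: h_def)
  define J where "J s = {2 * h * real s..<2 * h * real s + h}" for s
  define B where "B = (\<Union>s\<in>S. J s)"
  have B_less: "0 \<le> y \<and> y < 1 / 2" if "y \<in> B" for y
  proof -
    obtain s where s: "s \<in> S" "y \<in> J s" using \<open>y \<in> B\<close> by (auto simp: B_def)
    have "2 * h * real s \<ge> 0" using \<open>h > 0\<close> by simp
    have "real s + 1 \<le> N" using s(1) S(1) by auto
    then have "2 * h * (real s + 1) \<le> 2 * h * N" using \<open>h > 0\<close> by (intro mult_left_mono) auto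
    then have "2 * h * real s + 2 * h \<le> 1 / 2" using h_eq by (simp add: algebra_simps)
    then show ?thesis using s(2) \<open>h > 0\<close> \<open>2 * h * real s \<ge> 0\<close>
      unfolding J_def atLeastLessThan_iff by linarith
  qed
  show ?thesis
  proof (rule that[of B h])
    show "B \<in> sets borel" unfolding B_def J_def using finS by (intro sets.finite_UN) auto
    show "B \<subseteq> {0..<1}" using B_less by force
    show "0 < h" by fact
    show "h \<le> 1 / 2" using \<open>N > 0\<close> by (simp add: h_def field_simps)
    show "frac w \<in> {0..<h} \<union> {1 - h<..<1}"
      if y: "y \<in> B" "frac (y + w) \<in> B" "frac (y + 2 * w) \<in> B" for y w
    proof -
      define y2 y3 where "y2 = frac (y + w)" and "y3 = frac (y + 2 * w)"
      obtain m where m: "y + y3 - 2 * y2 = of_int m"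
      proof
        show "y + y3 - 2 * y2 = of_int (2 * \<lfloor>y + w\<rfloor> - \<lfloor>y + 2 * w\<rfloor>)"
          by (simp add: y2_def y3_def frac_def)
      qed
      have "\<bar>y + y3 - 2 * y2\<bar> < 1"
        using B_less[OF y(1)] B_less[OF y(2)] B_less[OF y(3)] unfolding y2_def y3_def by linarith
      then have "m = 0" using m by linarith
      then have mid: "y + y3 = 2 * y2" using m by simp
      obtain s1 s2 s3 where s: "s1 \<in> S" "s2 \<in> S" "s3 \<in> S" "y \<in> J s1" "y2 \<in> J s2" "y3 \<in> J s3"
        using y unfolding y2_def[symmetric] y3_def[symmetric] by (auto simp: B_def)
      have "\<bar>2 * h * (real s1 + real s3 - 2 * real s2)\<bar> < 2 * h * 1"
        using s(4-6) mid unfolding J_def by (simp add: algebra_simps abs_less_iff)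
      then have "\<bar>real s1 + real s3 - 2 * real s2\<bar> < 1"
        using \<open>h > 0\<close> by (simp add: abs_mult)
      then have "s1 + s3 = 2 * s2" by linarith
      then have "s1 = s2" using free s by blast
      then have close: "\<bar>y2 - y\<bar> < h" using s(4,5) unfolding J_def by auto
      have "frac w = frac (y2 - y)"
      proof -
        have "y2 - y = w + of_int (- \<lfloor>y + w\<rfloor>)" by (simp add: y2_def frac_def)
        then show ?thesis by (metis frac_add_of_int_right)
      qed
      moreover have "frac (y2 - y) = (if y2 - y \<ge> 0 then y2 - y else y2 - y + 1)"
        using close \<open>h \<le> 1 / 2\<close> unfolding frac_unique_iff by auto
      ultimately show ?thesis using close by auto
    qed
    have "measure lborel B = card S * h"
    proof -
      have "disjoint_family_on J S"
      proof (unfold disjoint_family_on_def, intro ballI impI)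
        have less: "J s \<inter> J t = {}" if "s < t" for s t
        proof -
          have "2 * h * (real s + 1) \<le> 2 * h * real t"
            using that \<open>h > 0\<close> by (intro mult_left_mono) auto
          then show ?thesis using \<open>h > 0\<close> unfolding J_def by (auto simp: algebra_simps)
        qed
        show "J s \<inter> J t = {}" if "s \<noteq> t" for s t
          using less[of s t] less[of t s] that by (cases s t rule: linorder_cases) auto
      qed
      then have "emeasure lborel B = (\<Sum>s\<in>S. emeasure lborel (J s))"
        unfolding B_def
        by (intro sum_emeasure[symmetric] finS) (auto simp: J_def[abs_def])
      also have "\<dots> = (\<Sum>s\<in>S. ennreal h)"
        using \<open>h > 0\<close> by (intro sum.cong) (auto simp: J_def)
      also have "\<dots> = ennreal (card S * h)" 
        using \<open>h > 0\<close> by (simp add: ennreal_mult ennreal_of_nat_eq_real_of_nat)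
      finally show ?thesis using \<open>h > 0\<close> by (simp add: measure_def)
    qed
    moreover have "2 * h < (card S * h) ^ L"
    proof -
      have d: "real d = (real k * 2 ^ (k + 2)) ^ L" by (simp add: d_def)
      have "real d ^ k \<le> real (card S) * (real k * (real d)\<^sup>2)"
        using S(2) by (metis of_nat_le_iff of_nat_mult of_nat_power)
      then have "1 / (real k * 2 ^ (k + 2) * (real d)\<^sup>2) \<le> card S * h"
        using \<open>k > 0\<close> \<open>d > 0\<close> by (simp add: h_def N_def field_simps power_mult_distrib)
      then have "(1 / (real k * 2 ^ (k + 2) * (real d)\<^sup>2)) ^ L \<le> (card S * h) ^ L"
        by (rule power_mono) simp
      moreover have "(1 / (real k * 2 ^ (k + 2) * (real d)\<^sup>2)) ^ L = 1 / real d ^ k"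
      proof -
        have "(real k * 2 ^ (k + 2) * (real d)\<^sup>2) ^ L = real d * (real d ^ 2) ^ L"
          by (subst power_mult_distrib) (simp add: d)
        also have "\<dots> = real d ^ k" by (simp add: k_def power_mult)
        finally show ?thesis by (simp add: power_one_over)
      qed
      moreover have "2 * h < 1 / real d ^ k"
      proof -
        have "(1::real) \<le> 2 ^ k" by simp
        then have "(1::real) < 2 * 2 ^ k" by linarith
        then show ?thesis using \<open>d > 0\<close> by (simp add: h_def N_def field_simps power_mult_distrib)
      qed
      ultimately show ?thesis by linarith
    qed
    ultimately show "2 * h < measure lborel B ^ L" by simp
  qed
qed

section \<open>The torus\<close>

definition torus :: "(real \<times> real) measure" where
  "torus = circle \<Otimes>\<^sub>M circle"

lemma space_torus: "space torus = {0..<1} \<times> {0..<1}"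
  by (simp add: torus_def space_pair_measure)

lemma prob_space_torus: "prob_space torus"
proof -
  interpret pair_prob_space circle circle ..
  show ?thesis unfolding torus_def by unfold_locales
qed

text \<open>
  The parameters \<open>a\<close>, \<open>k\<close>, \<open>c\<close> are the coordinates of an element of a Heisenberg group; \<open>k\<close> must be
  an integer for the map to respect the identification modulo 1.
\<close>

definition skew :: "real \<Rightarrow> int \<Rightarrow> real \<Rightarrow> real \<times> real \<Rightarrow> real \<times> real" where
  "skew a k c = (\<lambda>p\<in>space torus. (frac (fst p + a), frac (snd p + (of_int k * fst p + c))))"

lemma skew_apply:
  "x \<in> {0..<1} \<Longrightarrow> y \<in> {0..<1} \<Longrightarrow> skew a k c (x, y) = (frac (x + a), frac (y + (of_int k * x + c)))"
  by (simp add: skew_def space_torus)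

lemma skew_in_space: "p \<in> space torus \<Longrightarrow> skew a k c p \<in> space torus"
  by (auto simp: skew_def space_torus frac_lt_1)

lemma frac_of_int_times_frac: "frac (z + of_int k * frac x) = frac (z + of_int k * x)"
  for x z :: real
proof -
  have "z + of_int k * frac x = z + of_int k * x + of_int (- k * \<lfloor>x\<rfloor>)"
    by (simp add: frac_def algebra_simps)
  then show ?thesis by (metis frac_add_of_int_right)
qed

text \<open>
  The multiplication rule of the Heisenberg group. The term \<open>k a'\<close> arises because the outer map
  sees the first coordinate after it was moved by \<open>a'\<close>.
\<close>

lemma compose_skew:
  "compose (space torus) (skew a k c) (skew a' k' c') = skew (a + a') (k + k') (c + c' + of_int k * a')"
proof (rule extensionalityI)
  fix p assume p: "p \<in> space torus"
  obtain x y where xy: "p = (x, y)" "x \<in> {0..<1}" "y \<in> {0..<1}" using p by (auto simp: space_torus)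
  let ?u = "y + (of_int k' * x + c')"
  have "frac (frac ?u + (of_int k * frac (x + a') + c)) = frac (?u + (of_int k * frac (x + a') + c))"
    by (rule frac_add_simps)
  also have "?u + (of_int k * frac (x + a') + c) = ?u + c + of_int k * frac (x + a')"
    by simp
  also have "frac \<dots> = frac (?u + c + of_int k * (x + a'))"
    by (rule frac_of_int_times_frac)
  finally have "compose (space torus) (skew a k c) (skew a' k' c') p
      = (frac (x + a' + a), frac (?u + c + of_int k * (x + a')))"
    using xy by (simp add: compose_def skew_def space_torus frac_lt_1)
  also have "\<dots> = skew (a + a') (k + k') (c + c' + of_int k * a') p"
    using xy by (simp add: skew_def space_torus algebra_simps)
  finally show "compose (space torus) (skew a k c) (skew a' k' c') p
      = skew (a + a') (k + k') (c + c' + of_int k * a') p" .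
qed (auto simp: compose_def skew_def)

lemma skew_0: "skew 0 0 0 = (\<lambda>p\<in>space torus. p)"
  unfolding skew_def by (rule restrict_ext) (auto simp: space_torus frac_eq_id)

lemma compose_skew_apply:
  assumes "p \<in> space torus"
  shows "skew a k c (skew a' k' c' p) = skew (a + a') (k + k') (c + c' + of_int k * a') p"
  using assms by (simp only: compose_skew[symmetric] compose_eq)

lemma skew_Bij: "skew a k c \<in> Bij (space torus)"
proof -
  let ?g = "skew (- a) (- k) (of_int k * a - c)"
  have "bij_betw (skew a k c) (space torus) (space torus)"
  proof (rule bij_betw_byWitness[of _ ?g])
    show "\<forall>p\<in>space torus. ?g (skew a k c p) = p" "\<forall>p\<in>space torus. skew a k c (?g p) = p"
      by (simp_all add: compose_skew_apply skew_0)
  qed (auto simp: skew_in_space)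
  then show ?thesis by (simp add: Bij_def skew_def)
qed

section \<open>The group of skew maps\<close>

abbreviation torus_bijections :: "(real \<times> real \<Rightarrow> real \<times> real) monoid" where
  "torus_bijections \<equiv> BijGroup (space torus)"

interpretation torus_bijections: group torus_bijections
  by (rule group_BijGroup)

lemma skew_carrier [simp]: "skew a k c \<in> carrier torus_bijections"
  using skew_Bij by (simp add: BijGroup_def)

lemma mult_skew:
  "skew a k c \<otimes>\<^bsub>torus_bijections\<^esub> skew a' k' c' = skew (a + a') (k + k') (c + c' + of_int k * a')"
  using skew_Bij by (simp add: BijGroup_def compose_skew)

lemma one_torus_bijections: "\<one>\<^bsub>torus_bijections\<^esub> = skew 0 0 0"
  by (simp add: BijGroup_def skew_0)

lemma inv_skew: "inv\<^bsub>torus_bijections\<^esub> (skew a k c) = skew (- a) (- k) (of_int k * a - c)"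
  by (rule torus_bijections.inv_equality) (simp_all add: mult_skew one_torus_bijections)

lemma commutator_skew:
  "skew a k c \<otimes>\<^bsub>torus_bijections\<^esub> skew a' k' c' \<otimes>\<^bsub>torus_bijections\<^esub> inv\<^bsub>torus_bijections\<^esub> (skew a k c)
     \<otimes>\<^bsub>torus_bijections\<^esub> inv\<^bsub>torus_bijections\<^esub> (skew a' k' c') = skew 0 0 (of_int k * a' - of_int k' * a)"
  by (simp add: mult_skew inv_skew algebra_simps)

text \<open>
  The first coordinate advances by \<open>a\<close> at each step, so the shifts of the second coordinate
  accumulate \<open>k a (0 + 1 + \<dots> + (n - 1))\<close>.
\<close>

lemma int_pow_skew:
  "skew a k 0 [^]\<^bsub>torus_bijections\<^esub> (n::int)
     = skew (of_int n * a) (k * n) (of_int k * (a * of_int n * (of_int n - 1) / 2))"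
proof -
  have nat: "skew a k 0 [^]\<^bsub>torus_bijections\<^esub> m
     = skew (of_nat m * a) (k * int m) (of_int k * (a * of_nat m * (of_nat m - 1) / 2))" for m :: nat
  proof (induction m)
    case 0 show ?case by (simp add: one_torus_bijections)
  next
    case (Suc m)
    have "of_nat m * a + a = of_nat (Suc m) * a" "k * int m + k = k * int (Suc m)"
      by (simp_all add: algebra_simps)
    moreover have "of_int k * (a * of_nat m * (of_nat m - 1) / 2) + 0 + of_int (k * int m) * a
        = of_int k * (a * of_nat (Suc m) * (of_nat (Suc m) - 1) / 2)"
      by (simp add: field_simps)
    moreover have "skew a k 0 [^]\<^bsub>torus_bijections\<^esub> Suc m
        = skew (of_nat m * a) (k * int m) (of_int k * (a * of_nat m * (of_nat m - 1) / 2))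
            \<otimes>\<^bsub>torus_bijections\<^esub> skew a k 0"
      unfolding Suc.IH[symmetric] by (rule torus_bijections.nat_pow_Suc)
    ultimately show ?case unfolding mult_skew by presburger
  qed
  show ?thesis
  proof (cases n rule: int_cases2)
    case (nonneg m)
    show ?thesis unfolding nonneg int_pow_int nat of_int_of_nat_eq ..
  next
    case (nonpos m)
    have "skew a k 0 [^]\<^bsub>torus_bijections\<^esub> n = inv\<^bsub>torus_bijections\<^esub> (skew a k 0 [^]\<^bsub>torus_bijections\<^esub> m)"
      unfolding nonpos by (rule torus_bijections.int_pow_neg_int[OF skew_carrier])
    also have "\<dots> = skew (- (of_nat m * a)) (- (k * int m))
        (of_int (k * int m) * (of_nat m * a) - of_int k * (a * of_nat m * (of_nat m - 1) / 2))"
      unfolding nat by (rule inv_skew)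
    also have "of_int (k * int m) * (of_nat m * a) - of_int k * (a * of_nat m * (of_nat m - 1) / 2)
        = of_int k * (a * of_int n * (of_int n - 1) / 2)"
      by (simp add: nonpos field_simps)
    also have "- (of_nat m * a) = of_int n * a" by (simp add: nonpos)
    also have "- (k * int m) = k * n" by (simp add: nonpos)
    finally show ?thesis .
  qed
qed

definition skew_maps :: "(real \<times> real \<Rightarrow> real \<times> real) set" where
  "skew_maps = {skew a k c | a k c. True}"

definition vertical_rotations :: "(real \<times> real \<Rightarrow> real \<times> real) set" where
  "vertical_rotations = {skew 0 0 c | c. True}"

lemma skew_in_skew_maps [simp]: "skew a k c \<in> skew_maps"
  by (auto simp: skew_maps_def)

lemma skew_mapsE:
  assumes "f \<in> skew_maps" obtains a k c where "f = skew a k c"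
  using assms by (auto simp: skew_maps_def)

lemma skew_in_vertical_rotations [simp]: "skew 0 0 c \<in> vertical_rotations"
  by (auto simp: vertical_rotations_def)

lemma vertical_rotationsE:
  assumes "f \<in> vertical_rotations" obtains c where "f = skew 0 0 c"
  using assms by (auto simp: vertical_rotations_def)

lemma subgroup_skew_maps: "subgroup skew_maps torus_bijections"
proof (rule torus_bijections.subgroupI)
  show "skew_maps \<noteq> {}" using skew_in_skew_maps by blast
qed (auto elim!: skew_mapsE simp: inv_skew mult_skew)

lemma subgroup_vertical_rotations: "subgroup vertical_rotations torus_bijections"
proof (rule torus_bijections.subgroupI)
  show "vertical_rotations \<noteq> {}" using skew_in_vertical_rotations by blast
qed (auto elim!: vertical_rotationsE simp: inv_skew mult_skew)

text \<open>
  By \<open>commutator_skew\<close> a commutator of skew maps is a vertical rotation, that is \<open>a = k = 0\<close>, and the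
  same formula shows that vertical rotations commute with all skew maps.
\<close>

lemma step_nilpotent_skew:
  assumes Ts: "set Ts \<subseteq> skew_maps"
  shows "step_nilpotent 2 (transformation_group torus Ts)"
proof -
  define K where "K = transformation_group torus Ts"
  have K_eq: "K = subgroup_generated torus_bijections (set Ts)"
    by (simp add: K_def transformation_group_def)
  interpret K: group K unfolding K_eq by (rule torus_bijections.group_subgroup_generated)
  have K_skew: "carrier K \<subseteq> skew_maps"
    unfolding K_eq by (rule torus_bijections.subgroup_generated_minimal[OF subgroup_skew_maps Ts])
  have inv_K: "inv\<^bsub>K\<^esub> f = inv\<^bsub>torus_bijections\<^esub> f" if "f \<in> carrier K" for f
    using that unfolding K_eq by (rule torus_bijections.inv_subgroup_generated)
  have mult_K: "f \<otimes>\<^bsub>K\<^esub> g = f \<otimes>\<^bsub>torus_bijections\<^esub> g" for f g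
    by (simp add: K_eq)
  have subgroup_V: "subgroup (vertical_rotations \<inter> carrier K) K"
    unfolding K_eq torus_bijections.subgroup_subgroup_generated_iff
    using torus_bijections.subgroups_Inter_pair[OF subgroup_vertical_rotations
        torus_bijections.subgroup_subgroup_generated] by auto
  have "commutator_subgroup K (carrier K) (carrier K) \<subseteq> vertical_rotations \<inter> carrier K"
    unfolding commutator_subgroup_def
  proof (rule K.generate_subgroup_incl[OF _ subgroup_V], clarify)
    fix f g assume fg: "f \<in> carrier K" "g \<in> carrier K"
    then obtain a k c a' k' c' where "f = skew a k c" "g = skew a' k' c'"
      using K_skew by (meson skew_mapsE subsetD)
    then have "f \<otimes>\<^bsub>K\<^esub> g \<otimes>\<^bsub>K\<^esub> inv\<^bsub>K\<^esub> f \<otimes>\<^bsub>K\<^esub> inv\<^bsub>K\<^esub> g \<in> vertical_rotations"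
      using fg by (auto simp: inv_K mult_K commutator_skew)
    then show "f \<otimes>\<^bsub>K\<^esub> g \<otimes>\<^bsub>K\<^esub> inv\<^bsub>K\<^esub> f \<otimes>\<^bsub>K\<^esub> inv\<^bsub>K\<^esub> g \<in> vertical_rotations \<inter> carrier K"
      using fg by simp
  qed
  then have V: "lower_central_series K 1 \<subseteq> vertical_rotations \<inter> carrier K" by simp
  have "commutator_subgroup K (lower_central_series K 1) (carrier K) \<subseteq> {\<one>\<^bsub>K\<^esub>}"
    unfolding commutator_subgroup_def
  proof (rule K.generate_subgroup_incl[OF _ K.triv_subgroup], clarify)
    fix f g assume f: "f \<in> lower_central_series K 1" and g: "g \<in> carrier K"
    have "f \<in> carrier K" using f V by auto
    obtain c where "f = skew 0 0 c" using f V by (meson IntD1 subsetD vertical_rotationsE)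
    moreover obtain a' k' c' where "g = skew a' k' c'" using g K_skew by (meson skew_mapsE subsetD)
    moreover have "\<one>\<^bsub>K\<^esub> = skew 0 0 0" by (simp add: K_eq one_torus_bijections)
    ultimately show "f \<otimes>\<^bsub>K\<^esub> g \<otimes>\<^bsub>K\<^esub> inv\<^bsub>K\<^esub> f \<otimes>\<^bsub>K\<^esub> inv\<^bsub>K\<^esub> g = \<one>\<^bsub>K\<^esub>"
      using \<open>f \<in> carrier K\<close> g by (simp add: inv_K mult_K commutator_skew)
  qed
  moreover have "\<one>\<^bsub>K\<^esub> \<in> commutator_subgroup K (lower_central_series K 1) (carrier K)"
    unfolding commutator_subgroup_def by (rule generate.one)
  ultimately have "lower_central_series K 2 = {\<one>\<^bsub>K\<^esub>}"
    by (auto simp: numeral_2_eq_2)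
  then show ?thesis
    unfolding step_nilpotent_def K_def[symmetric] using K.group_axioms by blast
qed

section \<open>Invariance of the measure and ergodicity\<close>

lemma measurable_skew [measurable]: "skew a k c \<in> torus \<rightarrow>\<^sub>M torus"
proof -
  have [measurable]: "fst \<in> torus \<rightarrow>\<^sub>M borel" "snd \<in> torus \<rightarrow>\<^sub>M borel"
    unfolding torus_def
    using measurable_compose[OF measurable_fst measurable_id_circle_borel]
      measurable_compose[OF measurable_snd measurable_id_circle_borel]
    by (auto simp: eta_contract_eq)
  have "(\<lambda>p. (frac (fst p + a), frac (snd p + (of_int k * fst p + c)))) \<in> torus \<rightarrow>\<^sub>M circle \<Otimes>\<^sub>M circle"
    by measurable
  then show ?thesis
    unfolding torus_def[symmetric] by (subst measurable_cong[of torus _ "\<lambda>p. (frac (fst p + a), frac (snd p + (of_int k * fst p + c)))"])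
      (simp_all add: skew_def)
qed

lemma emeasure_torus: "A \<in> sets torus \<Longrightarrow> emeasure torus A = (\<integral>\<^sup>+x. emeasure circle (Pair x -` A) \<partial>circle)"
  unfolding torus_def by (rule circle.emeasure_pair_measure_alt)

lemma fibre_skew:
  assumes "x \<in> {0..<1}" "A \<subseteq> space torus"
  shows "Pair x -` (skew a k c -` A \<inter> space torus)
    = {y \<in> {0..<1}. frac (y + (of_int k * x + c)) \<in> Pair (frac (x + a)) -` A}"
  using assms by (auto simp: skew_apply space_torus)

lemma sets_torus_fibre: "A \<in> sets torus \<Longrightarrow> Pair x -` A \<in> sets circle"
  unfolding torus_def by (rule sets_Pair1)

lemma measurable_torus_fibre [measurable]:
  "A \<in> sets torus \<Longrightarrow> (\<lambda>x. emeasure circle (Pair x -` A)) \<in> borel_measurable circle"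
  unfolding torus_def by (rule circle.measurable_emeasure_Pair)

lemma emeasure_fibre_skew:
  assumes "A \<in> sets torus" "x \<in> {0..<1}"
  shows "emeasure circle (Pair x -` (skew a k c -` A \<inter> space torus))
    = emeasure circle (Pair (frac (x + a)) -` A)"
  using assms sets.sets_into_space[OF assms(1)]
  by (simp only: fibre_skew emeasure_circle_rotation sets_torus_fibre)

text \<open>
  On each vertical fibre a skew map is a rotation onto the fibre over the rotated base point, so the
  claim is rotation invariance of the circle measure, once in the fibres and once in the base.
\<close>

lemma emeasure_skew_vimage:
  assumes A: "A \<in> sets torus"
  shows "emeasure torus (skew a k c -` A \<inter> space torus) = emeasure torus A"
proof -
  have "emeasure torus (skew a k c -` A \<inter> space torus)
      = (\<integral>\<^sup>+x. emeasure circle (Pair x -` (skew a k c -` A \<inter> space torus)) \<partial>circle)"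
    by (rule emeasure_torus) (use A in measurable)
  also have "\<dots> = (\<integral>\<^sup>+x. emeasure circle (Pair (frac (x + a)) -` A) \<partial>circle)"
    by (rule nn_integral_cong) (simp only: emeasure_fibre_skew[OF A] space_circle)
  also have "\<dots> = (\<integral>\<^sup>+x. emeasure circle (Pair x -` A) \<partial>distr circle circle (\<lambda>x. frac (x + a)))"
    by (rule nn_integral_distr[symmetric]) (use A in measurable)
  also have "\<dots> = emeasure torus A"
    by (simp add: distr_circle_rotation emeasure_torus[OF A])
  finally show ?thesis .
qed

lemma measure_preserving_system_skew:
  assumes "set Ts \<subseteq> skew_maps"
  shows "measure_preserving_system torus Ts"
  unfolding measure_preserving_system_def
proof (intro conjI ballI prob_space_torus)
  fix T assume "T \<in> set Ts"
  then obtain a k c where T: "T = skew a k c" using assms by (meson skew_mapsE subsetD)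
  show "T \<in> Bij (space torus)" by (simp only: T skew_Bij)
  show "T \<in> torus \<rightarrow>\<^sub>M torus" unfolding T by measurable
  have eq: "inv_into (space torus) T p = skew (- a) (- k) (of_int k * a - c) p" if "p \<in> space torus" for p
    using that inv_BijGroup[OF skew_Bij, of a k c] by (simp add: T inv_skew)
  have "inv_into (space torus) T \<in> torus \<rightarrow>\<^sub>M torus \<longleftrightarrow>
      skew (- a) (- k) (of_int k * a - c) \<in> torus \<rightarrow>\<^sub>M torus"
    by (rule measurable_cong) (rule eq)
  then show "inv_into (space torus) T \<in> torus \<rightarrow>\<^sub>M torus" by simp
  show "emeasure torus (T -` A \<inter> space torus) = emeasure torus A" if "A \<in> sets torus" for A
    unfolding T using that by (rule emeasure_skew_vimage)
qed

lemma ergodic_system_skew: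
  assumes "\<alpha> \<notin> \<rat>"
  shows "ergodic_system torus [skew \<alpha> 1 0, skew \<alpha> 2 0]"
  unfolding ergodic_system_def
proof (intro ballI impI)
  fix A assume A: "A \<in> sets torus"
    and inv: "\<forall>T\<in>set [skew \<alpha> 1 0, skew \<alpha> 2 0]. T -` A \<inter> space torus = A"
  have inv1: "skew \<alpha> 1 0 -` A \<inter> space torus = A" and inv2: "skew \<alpha> 2 0 -` A \<inter> space torus = A"
    using inv by auto
  let ?F = "\<lambda>x. Pair x -` A"
  have vertical: "skew 0 0 \<alpha> p \<in> A \<longleftrightarrow> p \<in> A" if p: "p \<in> space torus" for p
  proof -
    \<comment> \<open>\<open>q\<close> is the preimage of \<open>p\<close> under \<open>T\<^sub>1 T\<^sub>2\<close>. Applying the two maps to \<open>q\<close> in the other order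
      gives \<open>p\<close> rotated by the commutator.\<close>
    define q where "q = skew (- (2 * \<alpha>)) (- 3) (5 * \<alpha>) p"
    have q: "q \<in> space torus" unfolding q_def using p by (rule skew_in_space)
    have "p = skew \<alpha> 1 0 (skew \<alpha> 2 0 q)" "skew 0 0 \<alpha> p = skew \<alpha> 2 0 (skew \<alpha> 1 0 q)"
      unfolding q_def using p by (simp_all add: compose_skew_apply skew_in_space skew_0 algebra_simps)
    then show ?thesis
      using inv1 inv2 q skew_in_space[OF q] by (metis Int_iff vimage_eq)
  qed
  have fibre: "emeasure circle (?F x) = 0 \<or> emeasure circle (?F x) = 1" if x: "x \<in> {0..<1}" for x
  proof (rule irrational_rotation_ergodic[OF \<open>\<alpha> \<notin> \<rat>\<close> sets_torus_fibre[OF A]])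
    fix y :: real assume "y \<in> {0..<1}"
    then show "frac (y + \<alpha>) \<in> ?F x \<longleftrightarrow> y \<in> ?F x"
      using vertical[of "(x, y)"] x by (simp add: skew_apply space_torus frac_eq_id)
  qed
  define E where "E = {x \<in> space circle. emeasure circle (?F x) = 1}"
  have E: "E \<in> sets circle" unfolding E_def using A by measurable
  have "emeasure circle E = 0 \<or> emeasure circle E = 1"
  proof (rule irrational_rotation_ergodic[OF \<open>\<alpha> \<notin> \<rat>\<close> E])
    fix x :: real assume "x \<in> {0..<1}"
    then show "frac (x + \<alpha>) \<in> E \<longleftrightarrow> x \<in> E"
      using emeasure_fibre_skew[OF A, of x \<alpha> 1 0] unfolding inv1 by (simp add: E_def frac_lt_1)
  qed
  moreover have "emeasure torus A = emeasure circle E"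
  proof -
    have "emeasure torus A = (\<integral>\<^sup>+x. indicator E x \<partial>circle)"
      unfolding emeasure_torus[OF A]
    proof (rule nn_integral_cong)
      fix x assume "x \<in> space circle"
      then show "emeasure circle (?F x) = indicator E x"
        using fibre[of x] by (auto simp: E_def indicator_def)
    qed
    then show ?thesis using E by simp
  qed
  ultimately show "measure torus A = 0 \<or> measure torus A = 1"
    by (auto simp: measure_def)
qed

section \<open>Returning to a horizontal strip\<close>

lemma measure_circle: "B \<subseteq> {0..<1} \<Longrightarrow> measure circle B = measure lborel B"
  by (simp add: measure_def emeasure_circle)

text \<open>
  The hypothesis says that progressions in \<open>B\<close> have differences near 0. A point of the intersection
  has such a progression with difference \<open>w = n x + \<alpha> n (n - 1) / 2\<close>, which confines \<open>x\<close> to the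
  preimage of a set of measure \<open>2 h\<close> under a measure-preserving map of the circle.
\<close>

lemma skew_triple_intersection:
  fixes n :: int
  assumes B: "B \<in> sets borel" "B \<subseteq> {0..<1}" and h: "0 < h" "h \<le> 1 / 2" and "n \<noteq> 0"
    and sparse: "\<And>y w. \<lbrakk>y \<in> B; frac (y + w) \<in> B; frac (y + 2 * w) \<in> B\<rbrakk> \<Longrightarrow> frac w \<in> {0..<h} \<union> {1 - h<..<1}"
  defines "A \<equiv> ({0..<1} :: real set) \<times> B"
  shows "measure torus (A \<inter> power_preimage torus (skew \<alpha> 1 0) n A \<inter> power_preimage torus (skew \<alpha> 2 0) n A) \<le> 2 * h"
proof -
  interpret torus: prob_space torus by (rule prob_space_torus)
  define c where "c = \<alpha> * of_int n * (of_int n - 1) / 2"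
  let ?Z = "{0..<h} \<union> {1 - h<..<1}"
  let ?f = "\<lambda>x. frac (real_of_int n * x + c)"
  let ?X = "?f -` ?Z \<inter> space circle"
  have Z: "?Z \<in> sets circle" using h by (auto simp: sets_circle_iff)
  then have X: "?X \<in> sets circle" by measurable
  have "A \<inter> power_preimage torus (skew \<alpha> 1 0) n A \<inter> power_preimage torus (skew \<alpha> 2 0) n A \<subseteq> ?X \<times> {0..<1}"
  proof
    fix p assume p: "p \<in> A \<inter> power_preimage torus (skew \<alpha> 1 0) n A \<inter> power_preimage torus (skew \<alpha> 2 0) n A"
    obtain x y where xy: "p = (x, y)" "x \<in> {0..<1}" "y \<in> B" "y \<in> {0..<1}"
      using p B(2) by (auto simp: A_def)
    have "(skew \<alpha> 1 0 [^]\<^bsub>torus_bijections\<^esub> n) p = (frac (x + of_int n * \<alpha>), frac (y + (of_int n * x + c)))"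
      using xy by (simp add: int_pow_skew skew_apply c_def)
    moreover have "(skew \<alpha> 2 0 [^]\<^bsub>torus_bijections\<^esub> n) p = (frac (x + of_int n * \<alpha>), frac (y + 2 * (of_int n * x + c)))"
      using xy by (simp add: int_pow_skew skew_apply c_def distrib_left mult.assoc)
    ultimately have "frac (y + (of_int n * x + c)) \<in> B" "frac (y + 2 * (of_int n * x + c)) \<in> B"
      using p by (auto simp: power_preimage_def A_def)
    from sparse[OF xy(3) this] show "p \<in> ?X \<times> {0..<1}" using xy by simp
  qed
  then have "measure torus (A \<inter> power_preimage torus (skew \<alpha> 1 0) n A \<inter> power_preimage torus (skew \<alpha> 2 0) n A)
      \<le> measure torus (?X \<times> {0..<1})"
    by (rule torus.finite_measure_mono) (use X in \<open>auto simp: torus_def simp flip: space_circle\<close>)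
  also have "\<dots> = measure circle ?X"
    unfolding torus_def using X circle.emeasure_space_1
    by (simp add: measure_def circle.emeasure_pair_measure_Times sets_circle_iff)
  also have "\<dots> = measure (distr circle circle ?f) ?Z"
    using Z by (intro measure_distr[symmetric]) auto
  also have "\<dots> = measure circle ?Z" by (simp only: distr_circle_affine[OF \<open>n \<noteq> 0\<close>])
  also have "\<dots> \<le> measure circle {0..<h} + measure circle {1 - h<..<1}"
    using h by (intro measure_Un_le) (auto simp: sets_circle_iff)
  also have "\<dots> = 2 * h"
  proof -
    have "{0..<h} \<subseteq> {0..<1}" "{1 - h<..<1} \<subseteq> {0..<1}" using h by auto
    then show ?thesis using h by (simp add: measure_circle)
  qed
  finally show ?thesis .
qed

theorem theorem1p4:
  "\<exists>(M :: (real \<times> real) measure) T1 T2.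
     measure_preserving_system M [T1, T2] \<and>
     step_nilpotent 2 (transformation_group M [T1, T2]) \<and>
     ergodic_system M [T1, T2] \<and>
     (\<forall>l::real. l > 0 \<longrightarrow>
        (\<exists>A\<in>sets M. \<forall>n::int. n \<noteq> 0 \<longrightarrow>
           measure M (A \<inter> power_preimage M T1 n A \<inter> power_preimage M T2 n A) < measure M A powr l))"
proof -
  obtain \<alpha> :: real where \<alpha>: "\<alpha> \<notin> \<rat>"
  proof -
    have "(\<rat> :: real set) \<noteq> UNIV"
    proof
      assume "(\<rat> :: real set) = UNIV"
      then have "countable (UNIV :: real set)" using countable_rat[where ?'a = real] by (rule subst)
      then show False using uncountable_UNIV_real by blast
    qed
    then show thesis using that by blast
  qed
  let ?T1 = "skew \<alpha> 1 0" and ?T2 = "skew \<alpha> 2 0"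
  have maps: "set [?T1, ?T2] \<subseteq> skew_maps" by simp
  have small: "\<exists>A\<in>sets torus. \<forall>n::int. n \<noteq> 0 \<longrightarrow>
      measure torus (A \<inter> power_preimage torus ?T1 n A \<inter> power_preimage torus ?T2 n A) < measure torus A powr l"
    if "l > 0" for l :: real
  proof -
    \<comment> \<open>A measure is at most 1, so the bound for the larger exponent \<open>L\<close> implies the one for \<open>l\<close>.\<close>
    define L where "L = nat \<lceil>l\<rceil>"
    have L: "l \<le> real L" "L > 0" using \<open>l > 0\<close> unfolding L_def by linarith+
    obtain B h where B: "B \<in> sets borel" "B \<subseteq> {0..<1}" and h: "0 < h" "h \<le> 1 / 2" "2 * h < measure lborel B ^ L"
      and sparse: "\<And>y w. \<lbrakk>y \<in> B; frac (y + w) \<in> B; frac (y + 2 * w) \<in> B\<rbrakk> \<Longrightarrow> frac w \<in> {0..<h} \<union> {1 - h<..<1}"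
      using exists_sparse_progression_set[of L] by metis
    define A where "A = ({0..<1} :: real set) \<times> B"
    have B': "B \<in> sets circle" using B by (simp add: sets_circle_iff)
    have A: "A \<in> sets torus" using B' by (auto simp: torus_def A_def simp flip: space_circle)
    have mA: "measure torus A = measure circle B"
      unfolding torus_def A_def using B' circle.emeasure_space_1
      by (simp add: measure_def circle.emeasure_pair_measure_Times sets_circle_iff)
    have "measure torus A ^ L \<le> measure torus A powr l"
    proof -
      have "measure lborel B \<noteq> 0"
      proof
        assume "measure lborel B = 0"
        then have "measure lborel B ^ L = 0" using L(2) by simp
        then show False using h by linarith
      qed
      then have "measure circle B > 0"
        using measure_nonneg[of lborel B] unfolding measure_circle[OF B(2)] by linarith
      then have "measure circle B ^ L = measure circle B powr L" by (simp add: powr_realpow)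
      also have "\<dots> \<le> measure circle B powr l" using L(1) by (intro powr_mono') auto
      finally show ?thesis by (simp add: mA)
    qed
    moreover have "2 * h < measure torus A ^ L" using h(3) by (simp add: mA measure_circle[OF B(2)])
    ultimately have "2 * h < measure torus A powr l" by linarith
    moreover have "measure torus (A \<inter> power_preimage torus ?T1 n A \<inter> power_preimage torus ?T2 n A) \<le> 2 * h"
      if "n \<noteq> 0" for n
      unfolding A_def by (rule skew_triple_intersection[OF B h(1,2) that sparse])
    ultimately have "measure torus (A \<inter> power_preimage torus ?T1 n A \<inter> power_preimage torus ?T2 n A)
        < measure torus A powr l" if "n \<noteq> 0" for n
      using that by (meson le_less_trans)
    with A show ?thesis by blast
  qed
  show ?thesis
  proof (intro exI conjI allI impI)
    show "measure_preserving_system torus [?T1, ?T2]"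
      by (rule measure_preserving_system_skew[OF maps])
    show "step_nilpotent 2 (transformation_group torus [?T1, ?T2])"
      by (rule step_nilpotent_skew[OF maps])
    show "ergodic_system torus [?T1, ?T2]"
      by (rule ergodic_system_skew[OF \<alpha>])
  qed (rule small)
qed

end
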